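(* Suppose that every $PG(3,2)$-free matroid $M'$ with $|M'|>(1-3\cdot 2^{-4})2^{r(M')}$ satisfies $\chi(M')\in\{3,4\}$. Then there is no $PG(4,2)$-free matroid $M$ with $|M|>(1-3\cdot 2^{-5})2^{r(M)}$ and $\chi(M)>5$.
   Context: A matroid $M$ means a simple binary matroid, represented by an integer $r(M)\geq 0$ (its rank) and a set $E(M)\subseteq \mathbb{F}_2^{r(M)}\setminus\{0\}$ that spans $\mathbb{F}_2^{r(M)}$; $|M|:=|E(M)|$. The critical number $\chi(M)$ is the smallest $k$ such that some subspace of $\mathbb{F}_2^{r(M)}$ of codimension $k$ is disjoint from $E(M)$. A matroid $M$ contains a matroid $N$ if there is an injective linear map $\iota:\mathbb{F}_2^{r(N)}\to\mathbb{F}_2^{r(M)}$ with $\iota(E(N))\subseteq E(M)$; $M$ is $N$-free if it does not contain $N$. The projective geometry $PG(s-1,2)$ is the matroid of rank $s$ with edge set $\mathbb{F}_2^s\setminus\{0\}$. *)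

theory Defs
  imports "Jordan_Normal_Form.VS_Connect" "HOL-Library.Z2"
begin

abbreviation F2 :: "bit ring" where
  "F2 \<equiv> class_ring"

abbreviation F2_space :: "nat \<Rightarrow> (bit, bit vec) module" where
  "F2_space n \<equiv> module_vec TYPE(bit) n"

record binary_matroid =
  mrank :: nat
  edges :: "bit vec set"

(* The record type only carries the data; matroid is the condition for it to be
   a simple binary matroid. *)
definition matroid :: "binary_matroid \<Rightarrow> bool" where
  "matroid M \<longleftrightarrow>
     edges M \<subseteq> carrier_vec (mrank M) - {0\<^sub>v (mrank M)} \<and>
     LinearCombinations.module.span F2 (F2_space (mrank M)) (edges M) = carrier_vec (mrank M)"

definition msize :: "binary_matroid \<Rightarrow> nat" where
  "msize M = card (edges M)"

(* U is a linear subspace of F_2^n of codimension k. *)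
definition subspace_codim :: "nat \<Rightarrow> bit vec set \<Rightarrow> nat \<Rightarrow> bool" where
  "subspace_codim n U k \<longleftrightarrow>
     VectorSpace.subspace F2 U (F2_space n) \<and>
     vectorspace.dim F2 (F2_space n\<lparr>carrier := U\<rparr>) + k = n"

(* The minimum exists for every matroid M: the zero subspace, of codimension mrank M,
   misses edges M. *)
definition critical_number :: "binary_matroid \<Rightarrow> nat" where
  "critical_number M =
     (LEAST k. \<exists>U. subspace_codim (mrank M) U k \<and> U \<inter> edges M = {})"

definition contains :: "binary_matroid \<Rightarrow> binary_matroid \<Rightarrow> bool" where
  "contains M N \<longleftrightarrow>
     (\<exists>\<iota>. linear_map F2 (F2_space (mrank N)) (F2_space (mrank M)) \<iota> \<and>
          inj_on \<iota> (carrier_vec (mrank N)) \<and>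
          \<iota> ` edges N \<subseteq> edges M)"

definition free_of :: "binary_matroid \<Rightarrow> binary_matroid \<Rightarrow> bool" where
  "free_of N M \<longleftrightarrow> \<not> contains M N"

(* PG n is the projective geometry PG(n,2); its rank is n + 1. *)
definition PG :: "nat \<Rightarrow> binary_matroid" where
  "PG n = \<lparr>mrank = n + 1, edges = carrier_vec (n + 1) - {0\<^sub>v (n + 1)}\<rparr>"

end

theory Submission
  imports Defs
begin

text \<open>
  In a counterexample of rank \<open>n\<close> with edge set \<open>E\<close> let \<open>A\<close> be the complement of \<open>E\<close>, and let
  \<open>u = 2 ^ (n - 5)\<close>, so that \<open>\<bar>A\<bar> < 3u\<close> and \<open>A\<close> contains no subspace of size \<open>u\<close>.

  Let \<open>H\<close> be a hyperplane. If \<open>E \<inter> H\<close> were \<open>PG(3,2)\<close>-free, the hypothesis would give a subspace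
  of size \<open>u\<close> in \<open>A\<close>; so \<open>E \<inter> H\<close> contains a \<open>PG(3,2)\<close>, each of whose translates outside \<open>H\<close>
  meets \<open>A\<close>, and \<open>\<bar>A - H\<bar> \<ge> u\<close>. Averaging over three hyperplanes, \<open>\<bar>A - K\<bar> \<ge> 3u/2\<close> for \<open>K\<close> of
  codimension 2. On the other hand, for \<open>e \<in> E\<close> and a hyperplane \<open>H\<close> avoiding \<open>e\<close>, the set
  \<open>{x \<in> H. x \<in> E \<and> e + x \<in> E}\<close> is dense in \<open>H\<close> and \<open>PG(3,2)\<close>-free, so the hypothesis yields a
  subspace \<open>W\<^sub>e \<ni> e\<close> of size \<open>2u\<close> inside \<open>A \<union> (e + A)\<close>; in particular \<open>\<bar>A \<inter> W\<^sub>e\<bar> \<ge> u\<close>.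

  The codimension 2 bound excludes \<open>\<bar>W\<^sub>e \<inter> W\<^sub>f\<bar> = u/2\<close>, so two of these subspaces share either at
  least \<open>u\<close> or at most \<open>u/4\<close> vectors. A second moment count shows that at most 8 of them
  pairwise share at most \<open>u/4\<close>. Finally, at most \<open>3u\<close> of the \<open>e \<in> E\<close> have a \<open>W\<^sub>e\<close> sharing at least
  \<open>u\<close> vectors with a given one: such \<open>W\<^sub>e\<close> either all contain a common \<open>Y\<close> of size \<open>u\<close>, and then
  \<open>e + g \<in> A\<close> for any fixed \<open>g \<in> Y - A\<close>, or all lie in a common subspace of size \<open>4u\<close>, of
  which \<open>A\<close> covers at least \<open>u\<close>. Hence \<open>\<bar>E\<bar> \<le> 24u\<close>, whereas \<open>\<bar>E\<bar> > 29u\<close>.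
\<close>

subsection \<open>Subspaces of binary vector spaces\<close>

text \<open>These rules would rewrite \<^term>\<open>F2\<close> itself to a record over \<open>xor\<close> and \<open>and\<close>, to which
  the facts about \<open>class_ring\<close> no longer apply.\<close>

declare add_bit_eq_xor [simp del] mult_bit_eq_and [simp del]

text \<open>The only scalars of F_2 are 0 and 1, so zero and closure under addition already give a
  linear subspace.\<close>

definition bsubspace :: "nat \<Rightarrow> bit vec set \<Rightarrow> bool" where
  "bsubspace n S \<longleftrightarrow> S \<subseteq> carrier_vec n \<and> 0\<^sub>v n \<in> S \<and> (\<forall>x\<in>S. \<forall>y\<in>S. x + y \<in> S)"

text \<open>For a subspace \<open>S\<close> this is the span of \<open>S\<close> and
  \<open>p\<close>; it is \<open>S\<close> itself when \<open>p\<close> lies in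
  \<open>S\<close>.\<close>

definition adjoin :: "bit vec \<Rightarrow> bit vec set \<Rightarrow> bit vec set" where
  "adjoin p S = S \<union> (+) p ` S"

lemma bit_add_self: "(x :: bit) + x = 0"
  by (cases x) simp_all

lemma bvec_add_self: "x \<in> carrier_vec n \<Longrightarrow> (x :: bit vec) + x = 0\<^sub>v n"
  by (intro eq_vecI) (auto simp: bit_add_self)

lemma bvec_add_cancel:
  assumes "x \<in> carrier_vec n" "y \<in> carrier_vec n"
  shows "(x :: bit vec) + (x + y) = y"
  using assms by (simp add: assoc_add_vec[symmetric] bvec_add_self)

lemma bvec_add_swap:
  assumes "a \<in> carrier_vec n" "b \<in> carrier_vec n" "c \<in> carrier_vec n" "d \<in> carrier_vec n"
  shows "((a :: bit vec) + b) + (c + d) = (a + c) + (b + d)"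
  using assms by (intro eq_vecI) (auto simp: ac_simps)

lemma inj_on_bvec_add:
  assumes "x \<in> carrier_vec n" "S \<subseteq> carrier_vec n"
  shows "inj_on ((+) (x :: bit vec)) S"
  using assms by (intro inj_onI) (metis bvec_add_cancel subsetD)

lemma card_bvec_translate:
  assumes "x \<in> carrier_vec n" "S \<subseteq> carrier_vec n"
  shows "card ((+) (x :: bit vec) ` S) = card S"
  using inj_on_bvec_add[OF assms] by (rule card_image)

lemma bij_betw_bit_fun_carrier_vec:
  "bij_betw (vec n) ({..<n} \<rightarrow>\<^sub>E (UNIV :: bit set)) (carrier_vec n)"
proof (rule bij_betwI[where g = "\<lambda>v. restrict (($) v) {..<n}"])
  show "vec n \<in> ({..<n} \<rightarrow>\<^sub>E (UNIV :: bit set)) \<rightarrow> carrier_vec n"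
    by auto
  show "(\<lambda>v. restrict (($) v) {..<n}) \<in> carrier_vec n \<rightarrow> ({..<n} \<rightarrow>\<^sub>E (UNIV :: bit set))"
    by auto
qed (auto simp: PiE_def extensional_def restrict_def)

lemma card_UNIV_bit: "card (UNIV :: bit set) = 2"
proof -
  have "(UNIV :: bit set) = {0, 1}" by (auto intro: bit.exhaust)
  then show ?thesis by (simp only: card_2_iff) (metis bit.distinct(1))
qed

lemma finite_carrier_bvec: "finite (carrier_vec n :: bit vec set)"
  using bij_betw_finite[OF bij_betw_bit_fun_carrier_vec[of n]]
  by (simp add: finite_PiE card_ge_0_finite card_UNIV_bit)

lemma card_carrier_bvec: "card (carrier_vec n :: bit vec set) = 2 ^ n"
  using bij_betw_same_card[OF bij_betw_bit_fun_carrier_vec[of n]]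
  by (simp add: card_PiE card_UNIV_bit)

lemma bsubspace_carrier: "bsubspace n S \<Longrightarrow> S \<subseteq> carrier_vec n"
  and bsubspace_zero: "bsubspace n S \<Longrightarrow> 0\<^sub>v n \<in> S"
  and bsubspace_add: "bsubspace n S \<Longrightarrow> x \<in> S \<Longrightarrow> y \<in> S \<Longrightarrow> x + y \<in> S"
  by (auto simp: bsubspace_def)

lemma bsubspace_finite: "bsubspace n S \<Longrightarrow> finite S"
  using finite_carrier_bvec finite_subset bsubspace_carrier by blast

lemma bsubspace_Int: "bsubspace n S \<Longrightarrow> bsubspace n T \<Longrightarrow> bsubspace n (S \<inter> T)"
  by (auto simp: bsubspace_def)

lemma bsubspace_UNIV: "bsubspace n (carrier_vec n)"
  by (auto simp: bsubspace_def)

lemma bsubspace_singleton_zero: "bsubspace n {0\<^sub>v n}"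
  by (auto simp: bsubspace_def)

lemma bsubspace_add_iff:
  assumes "bsubspace n S" "x \<in> S" "y \<in> carrier_vec n"
  shows "x + y \<in> S \<longleftrightarrow> y \<in> S"
  using assms bvec_add_cancel bsubspace_add bsubspace_carrier by (metis subsetD)

lemma adjoin_self: "bsubspace n S \<Longrightarrow> p \<in> carrier_vec n \<Longrightarrow> p \<in> adjoin p S"
  unfolding adjoin_def using bsubspace_zero right_zero_vec by (metis UnI2 image_eqI)

lemma adjoin_superset: "S \<subseteq> adjoin p S"
  by (simp add: adjoin_def)

lemma adjoin_mono: "S \<subseteq> T \<Longrightarrow> adjoin p S \<subseteq> adjoin p T"
  by (auto simp: adjoin_def)

lemma adjoin_subset: "bsubspace n T \<Longrightarrow> S \<subseteq> T \<Longrightarrow> p \<in> T \<Longrightarrow> adjoin p S \<subseteq> T"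
  by (auto simp: adjoin_def bsubspace_add)

lemma bsubspace_adjoin:
  assumes S: "bsubspace n S" and p: "p \<in> carrier_vec n"
  shows "bsubspace n (adjoin p S)"
proof -
  have c: "x \<in> carrier_vec n" if "x \<in> S" for x
    using S that bsubspace_carrier by blast
  have "x + y \<in> adjoin p S" if xy: "x \<in> adjoin p S" "y \<in> adjoin p S" for x y
  proof -
    have 1: "s + (p + t) = p + (s + t)" "(p + s) + t = p + (s + t)" "(p + s) + (p + t) = s + t"
      if "s \<in> S" "t \<in> S" for s t
    proof -
      note st = c[OF that(1)] c[OF that(2)]
      show "(p + s) + t = p + (s + t)" using st p by (simp add: assoc_add_vec)
      show "s + (p + t) = p + (s + t)" using st p
        by (intro eq_vecI) (auto simp: add.left_commute)
      show "(p + s) + (p + t) = s + t"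
        unfolding bvec_add_swap[OF p st(1) p st(2)] bvec_add_self[OF p] using st by simp
    qed
    show ?thesis using xy bsubspace_add[OF S] 1 unfolding adjoin_def by (auto; metis imageI)
  qed
  moreover have "adjoin p S \<subseteq> carrier_vec n" using p c by (auto simp: adjoin_def)
  ultimately show ?thesis using bsubspace_zero[OF S] by (auto simp: bsubspace_def adjoin_def)
qed

lemma translate_disjoint:
  assumes S: "bsubspace n S" and p: "p \<in> carrier_vec n" "p \<notin> S"
  shows "S \<inter> (+) p ` S = {}"
proof -
  have "p + s \<notin> S" if "s \<in> S" for s
    using that p bsubspace_add_iff[OF S that p(1)] bsubspace_carrier[OF S] comm_add_vec
    by (metis subsetD)
  then show ?thesis by auto
qed

lemma card_adjoin:
  assumes S: "bsubspace n S" and p: "p \<in> carrier_vec n" "p \<notin> S"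
  shows "card (adjoin p S) = 2 * card S"
  unfolding adjoin_def using card_bvec_translate[OF p(1) bsubspace_carrier[OF S]]
  by (subst card_Un_disjoint) (auto simp: bsubspace_finite[OF S] translate_disjoint[OF assms])

text \<open>A vector of \<open>T\<close> outside \<open>S\<close> yields a second, disjoint coset of
  \<open>S\<close> inside \<open>T\<close>. Sizes do the work of dimensions from here on.\<close>

lemma bsubspace_proper_card:
  assumes "bsubspace n S" "bsubspace n T" "S \<subseteq> T" "S \<noteq> T"
  shows "2 * card S \<le> card T"
proof -
  obtain p where p: "p \<in> T" "p \<notin> S" using assms by auto
  have pc: "p \<in> carrier_vec n" using p assms bsubspace_carrier by blast
  show ?thesis
    using card_mono[OF bsubspace_finite[OF assms(2)] adjoin_subset[OF assms(2,3) p(1)]]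
      card_adjoin[OF assms(1) pc p(2)] by simp
qed

lemma bsubspace_card_pos: "bsubspace n S \<Longrightarrow> card S > 0"
  using bsubspace_finite bsubspace_zero card_gt_0_iff by blast

lemma bsubspace_eqI:
  assumes "bsubspace n S" "bsubspace n T" "S \<subseteq> T" "card T < 2 * card S"
  shows "S = T"
  using bsubspace_proper_card[OF assms(1-3)] assms(4) by force

lemma bsubspace_between:
  assumes S: "bsubspace n S" and T: "bsubspace n T" "S \<subseteq> T" and le: "card S * 2 ^ j \<le> card T"
  shows "\<exists>U. bsubspace n U \<and> S \<subseteq> U \<and> U \<subseteq> T \<and> card U = card S * 2 ^ j"
  using le
proof (induction j)
  case 0
  then show ?case using S T by auto
next
  case (Suc j)
  then obtain U where U: "bsubspace n U" "S \<subseteq> U" "U \<subseteq> T" "card U = card S * 2 ^ j" by force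
  have "card U < card T" 
  proof -
    have "card S * 2 ^ j < card S * 2 ^ Suc j" using bsubspace_card_pos[OF S] by simp
    then show ?thesis using U(4) Suc.prems by linarith
  qed
  then have "U \<noteq> T" using U(4) by auto
  then obtain p where p: "p \<in> T" "p \<notin> U" using U by auto
  have pc: "p \<in> carrier_vec n" using p T bsubspace_carrier by blast
  show ?case
    using bsubspace_adjoin[OF U(1) pc] adjoin_subset[OF T(1) U(3) p(1)] adjoin_superset[of U p] U(2)
      card_adjoin[OF U(1) pc p(2)] U(4) by (intro exI[of _ "adjoin p U"]) auto
qed

text \<open>The subspace of \<open>S\<close> whose size is the largest power of two below or equal
  to \<open>card S\<close> takes up more than half of \<open>S\<close>, hence is
  \<open>S\<close>.\<close>

lemma bsubspace_card_power:
  assumes S: "bsubspace n S"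
  shows "\<exists>k. card S = 2 ^ k"
proof -
  obtain k where k: "2 ^ k \<le> card S" "card S < 2 ^ Suc k"
    using ex_power_ivl1[of 2 "card S"] bsubspace_card_pos[OF S] by fastforce
  obtain U where U: "bsubspace n U" "U \<subseteq> S" "card U = 2 ^ k"
    using bsubspace_between[OF bsubspace_singleton_zero S, of k] k bsubspace_zero[OF S] by auto
  have "U = S" using bsubspace_eqI[OF U(1) S U(2)] k U(3) by simp
  then show ?thesis using U by auto
qed

text \<open>A largest subspace \<open>H\<close> avoiding \<open>e\<close> works: adjoining any
  further \<open>x\<close> must capture \<open>e\<close>, so \<open>x\<close> lies in
  \<open>e + H\<close> and \<open>H\<close> has only two cosets.\<close>

lemma bsubspace_hyperplane_avoiding:
  assumes e: "e \<in> carrier_vec n" "e \<noteq> 0\<^sub>v n"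
  shows "\<exists>H. bsubspace n H \<and> 2 * card H = 2 ^ n \<and> e \<notin> H"
proof -
  let ?P = "\<lambda>H. bsubspace n H \<and> e \<notin> H"
  have "?P {0\<^sub>v n}" using e bsubspace_singleton_zero by auto
  moreover have "\<forall>H. ?P H \<longrightarrow> card H < Suc (2 ^ n)"
    using card_mono[OF finite_carrier_bvec bsubspace_carrier] card_carrier_bvec
    by (metis less_Suc_eq_le)
  ultimately obtain H where H: "?P H" "\<And>G. ?P G \<Longrightarrow> card G \<le> card H"
    using ex_has_greatest_nat[of ?P "{0\<^sub>v n}" card "Suc (2 ^ n)"] by auto
  have "x \<in> adjoin e H" if x: "x \<in> carrier_vec n" for x
  proof (cases "x \<in> H")
    case True then show ?thesis by (simp add: adjoin_def)
  next
    case False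
    have "e \<in> adjoin x H"
      using H(2)[of "adjoin x H"] bsubspace_adjoin[of n H x] x H(1) card_adjoin[of n H x] False
        bsubspace_card_pos[of n H] by auto
    then obtain h where h: "h \<in> H" "e = x + h" using H(1) by (auto simp: adjoin_def)
    have hc: "h \<in> carrier_vec n" using h H(1) bsubspace_carrier by blast
    have "x = e + h" using h hc x e
      by (metis bvec_add_cancel comm_add_vec)
    then show ?thesis using h by (auto simp: adjoin_def)
  qed
  then have "adjoin e H = carrier_vec n"
    using bsubspace_carrier[OF bsubspace_adjoin[of n H e]] H(1) e by auto
  then have "2 * card H = 2 ^ n"
    using card_adjoin[of n H e] H(1) e card_carrier_bvec by simp
  then show ?thesis using H(1) by auto
qed

subsection \<open>Linear maps, dimension and the critical number\<close>

definition additive_map :: "nat \<Rightarrow> nat \<Rightarrow> (bit vec \<Rightarrow> bit vec) \<Rightarrow> bool" where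
  "additive_map k n f \<longleftrightarrow> f ` carrier_vec k \<subseteq> carrier_vec n \<and>
     (\<forall>x\<in>carrier_vec k. \<forall>y\<in>carrier_vec k. f (x + y) = f x + f y)"

lemma additive_map_zero:
  assumes "additive_map k n f"
  shows "f (0\<^sub>v k) = 0\<^sub>v n"
proof -
  have "f (0\<^sub>v k) = f (0\<^sub>v k + 0\<^sub>v k)" by simp
  also have "\<dots> = f (0\<^sub>v k) + f (0\<^sub>v k)"
    using assms zero_carrier_vec unfolding additive_map_def by blast
  also have "\<dots> = 0\<^sub>v n" using assms by (intro bvec_add_self) (auto simp: additive_map_def)
  finally show ?thesis .
qed

lemma linear_map_iff_additive:
  "linear_map F2 (F2_space k) (F2_space n) f \<longleftrightarrow> additive_map k n f"
proof
  assume "linear_map F2 (F2_space k) (F2_space n) f"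
  then have "f \<in> LinearCombinations.module_hom F2 (F2_space k) (F2_space n)"
    by (auto simp: linear_map_def mod_hom_def mod_hom_axioms_def)
  then show "additive_map k n f"
    by (auto simp: LinearCombinations.module_hom_def additive_map_def module_vec_simps)
next
  assume f: "additive_map k n f"
  have "f (r \<cdot>\<^sub>v v) = r \<cdot>\<^sub>v f v" if "v \<in> carrier_vec k" for r v
  proof (cases r)
    case zero
    have "f v \<in> carrier_vec n" using f that by (auto simp: additive_map_def)
    moreover have "(0 :: bit) \<cdot>\<^sub>v w = 0\<^sub>v m" if "w \<in> carrier_vec m" for w m
      using that by auto
    ultimately show ?thesis using zero additive_map_zero[OF f] that by metis
  qed (use that in simp)
  then have "f \<in> LinearCombinations.module_hom F2 (F2_space k) (F2_space n)"
    using f by (auto simp: LinearCombinations.module_hom_def additive_map_def module_vec_simps)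
  then show "linear_map F2 (F2_space k) (F2_space n) f"
    by (auto simp: linear_map_def mod_hom_def mod_hom_axioms_def vec_vs vec_module)
qed

lemma subspace_iff_bsubspace: "VectorSpace.subspace F2 U (F2_space n) \<longleftrightarrow> bsubspace n U"
proof
  assume "VectorSpace.subspace F2 U (F2_space n)"
  then have "submodule F2 U (F2_space n)" by (simp add: subspace_def)
  then show "bsubspace n U"
    by (auto simp: submodule_def bsubspace_def module_vec_simps)
next
  assume U: "bsubspace n U"
  have "c \<cdot>\<^sub>v v \<in> U" if "v \<in> U" for c v
  proof (cases c)
    case zero
    have "v \<in> carrier_vec n" using that U bsubspace_carrier by blast
    then have "(0 :: bit) \<cdot>\<^sub>v v = 0\<^sub>v n" by auto
    then show ?thesis using zero bsubspace_zero[OF U] by metis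
  qed (use that in simp)
  then have "submodule F2 U (F2_space n)"
    using U vec_module[of n, where 'a = bit] by (auto simp: submodule_def bsubspace_def module_vec_simps)
  then show "VectorSpace.subspace F2 U (F2_space n)"
    by (simp add: subspace_def vec_vs)
qed

lemma additive_map_image_bsubspace:
  assumes f: "additive_map k n f" and S: "bsubspace k S"
  shows "bsubspace n (f ` S)"
proof -
  have "f x + f y \<in> f ` S" if "x \<in> S" "y \<in> S" for x y
  proof -
    have "f (x + y) = f x + f y"
      using f that bsubspace_carrier[OF S] unfolding additive_map_def by (meson subsetD)
    then show ?thesis using bsubspace_add[OF S that] by (metis imageI)
  qed
  moreover have "f ` S \<subseteq> carrier_vec n"
    using f bsubspace_carrier[OF S] unfolding additive_map_def by blast
  moreover have "0\<^sub>v n \<in> f ` S"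
    using additive_map_zero[OF f] bsubspace_zero[OF S] by (rule image_eqI[OF sym])
  ultimately show ?thesis unfolding bsubspace_def by blast
qed

text \<open>Induction on the dimension: the first \<open>k\<close> entries are coordinates for a
  subspace \<open>T\<close> of half the size, and the last entry decides whether a fixed
  \<open>p\<close> outside \<open>T\<close> is added.\<close>

lemma bsubspace_coordinates:
  assumes "bsubspace n S" "card S = 2 ^ k"
  shows "\<exists>f. additive_map k n f \<and> bij_betw f (carrier_vec k) S"
  using assms
proof (induction k arbitrary: S)
  case 0
  have "S = {0\<^sub>v n}" using 0 bsubspace_zero card_1_singletonE by (metis One_nat_def power_0 singletonD)
  moreover have "(carrier_vec 0 :: bit vec set) = {0\<^sub>v 0}" by auto
  ultimately show ?case
    by (intro exI[of _ "\<lambda>_. 0\<^sub>v n"]) (auto simp: additive_map_def bij_betw_def)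
next
  case (Suc k)
  obtain T where T: "bsubspace n T" "T \<subseteq> S" "card T = 2 ^ k"
    using bsubspace_between[OF bsubspace_singleton_zero Suc.prems(1), of k] Suc.prems bsubspace_zero[OF Suc.prems(1)]
    by auto
  obtain g where g: "additive_map k n g" "bij_betw g (carrier_vec k) T"
    using Suc.IH[OF T(1,3)] by blast
  have "T \<noteq> S" using T Suc.prems by auto
  then obtain p where p: "p \<in> S" "p \<notin> T" using T by auto
  have pc: "p \<in> carrier_vec n" using p Suc.prems bsubspace_carrier by blast
  define f where "f v = (if v $ k = 1 then p else 0\<^sub>v n) + g (vec_first v k)" for v
  have first: "vec_first v k \<in> carrier_vec k" for v :: "bit vec" by simp
  have gc: "g x \<in> carrier_vec n" if "x \<in> carrier_vec k" for x
    using g that by (auto simp: additive_map_def)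
  have add: "f (x + y) = f x + f y" if "x \<in> carrier_vec (Suc k)" "y \<in> carrier_vec (Suc k)" for x y
  proof -
    have 1: "vec_first (x + y) k = vec_first x k + vec_first y k"
      using that by (auto simp: vec_first_def)
    let ?a = "if x $ k = 1 then p else 0\<^sub>v n" and ?b = "if y $ k = 1 then p else 0\<^sub>v n"
    have ab: "?a \<in> carrier_vec n" "?b \<in> carrier_vec n" using pc by auto
    have "(x + y) $ k = x $ k + y $ k" using that by auto
    then have 2: "(if (x + y) $ k = 1 then p else 0\<^sub>v n) = ?a + ?b"
      using pc bvec_add_self[OF pc] by (cases "x $ k"; cases "y $ k") auto
    have 3: "g (vec_first x k + vec_first y k) = g (vec_first x k) + g (vec_first y k)"
      using g first by (auto simp: additive_map_def)
    show ?thesis unfolding f_def 1 2 3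
      by (rule bvec_add_swap[OF ab gc[OF first] gc[OF first]])
  qed
  have fS: "f v \<in> S" for v
  proof -
    have "g (vec_first v k) \<in> S" using g T first by (auto simp: bij_betw_def)
    then show ?thesis
      using Suc.prems(1) p bsubspace_add bsubspace_zero unfolding f_def by auto
  qed
  have am: "additive_map (Suc k) n f"
    using fS bsubspace_carrier[OF Suc.prems(1)] add by (auto simp: additive_map_def)
  have surj: "S \<subseteq> f ` carrier_vec (Suc k)"
  proof -
    have "bsubspace n (f ` carrier_vec (Suc k))"
      by (rule additive_map_image_bsubspace[OF am bsubspace_UNIV])
    moreover have "T \<subseteq> f ` carrier_vec (Suc k)"
    proof
      fix t assume "t \<in> T"
      then obtain w where w: "w \<in> carrier_vec k" "g w = t" using g by (auto simp: bij_betw_def)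
      let ?v = "vec (Suc k) (\<lambda>i. if i < k then w $ i else 0)"
      have "vec_first ?v k = w" using w by (auto simp: vec_first_def)
      then have "f ?v = 0\<^sub>v n + t" using w by (simp add: f_def)
      then have "f ?v = t" using w gc[OF w(1)] by simp
      then show "t \<in> f ` carrier_vec (Suc k)" by (rule image_eqI[OF sym vec_carrier])
    qed
    moreover have "p \<in> f ` carrier_vec (Suc k)"
    proof -
      let ?v = "vec (Suc k) (\<lambda>i. if i < k then 0 else 1)"
      have first0: "vec_first ?v k = 0\<^sub>v k" by (auto simp: vec_first_def)
      have "f ?v = p + 0\<^sub>v n" unfolding f_def first0 additive_map_zero[OF g(1)] by simp
      then have "f ?v = p" using pc by simp
      then show ?thesis by (rule image_eqI[OF sym vec_carrier])
    qed
    ultimately have "adjoin p T \<subseteq> f ` carrier_vec (Suc k)"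
      by (intro adjoin_subset)
    moreover have "adjoin p T = S"
      using bsubspace_eqI[OF bsubspace_adjoin[OF T(1) pc] Suc.prems(1) adjoin_subset[OF Suc.prems(1) T(2) p(1)]]
        card_adjoin[OF T(1) pc p(2)] T Suc.prems(2) by simp
    ultimately show ?thesis by simp
  qed
  then have im: "f ` carrier_vec (Suc k) = S" using fS by auto
  then have "inj_on f (carrier_vec (Suc k))"
    using Suc.prems(2) card_carrier_bvec finite_carrier_bvec by (intro eq_card_imp_inj_on) auto
  then show ?case using am im by (auto simp: bij_betw_def)
qed

text \<open>Rank-nullity for a coordinate map, whose kernel is trivial.\<close>

lemma bsubspace_dim:
  assumes S: "bsubspace n S" and k: "card S = 2 ^ k"
  shows "vectorspace.dim F2 (F2_space n\<lparr>carrier := S\<rparr>) = k"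
proof -
  obtain f where f: "additive_map k n f" "bij_betw f (carrier_vec k) S"
    using bsubspace_coordinates[OF assms] by blast
  interpret linear_map F2 "F2_space k" "F2_space n" f
    using f(1) by (simp add: linear_map_iff_additive)
  have im: "imT = S" using f(2) by (auto simp: im_def bij_betw_def module_vec_simps)
  have fd: "V.fin_dim" using vec_space.fin_dim .
  have "inj_on f (carrier (F2_space k))" using f(2) by (simp add: bij_betw_def module_vec_simps)
  then have "vectorspace.dim F2 (V.vs kerT) = 0" by (rule inj_imp_dim_ker0)
  then have "vectorspace.dim F2 (F2_space n\<lparr>carrier := S\<rparr>) = V.dim"
    using rank_nullity[OF fd] im by simp
  also have "\<dots> = k" using vec_space.dim_is_n .
  finally show ?thesis .
qed

lemma subspace_codim_iff: "subspace_codim n U c \<longleftrightarrow> bsubspace n U \<and> card U * 2 ^ c = 2 ^ n"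
proof (cases "bsubspace n U")
  case True
  then obtain k where k: "card U = 2 ^ k" using bsubspace_card_power by blast
  have "(2 :: nat) ^ k * 2 ^ c = 2 ^ n \<longleftrightarrow> k + c = n"
    by (simp flip: power_add)
  then show ?thesis
    using True bsubspace_dim[OF True k] k by (simp add: subspace_codim_def subspace_iff_bsubspace)
qed (simp add: subspace_codim_def subspace_iff_bsubspace)

text \<open>The span contains more than half of all vectors, so it cannot be a proper
  subspace.\<close>

lemma matroid_if_dense:
  assumes "E \<subseteq> carrier_vec n - {0\<^sub>v n}" "2 ^ n < 2 * card E"
  shows "matroid \<lparr>mrank = n, edges = E\<rparr>"
proof -
  interpret vec_space "TYPE(bit)" n .
  have sub: "bsubspace n (span E)"
    using span_is_subspace[of E] assms(1) subspace_iff_bsubspace by auto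
  have "E \<subseteq> span E" using assms(1) in_own_span[of E] by auto
  then have "card E \<le> card (span E)" using card_mono bsubspace_finite[OF sub] by blast
  then have "span E = carrier_vec n"
    using bsubspace_eqI[OF sub bsubspace_UNIV bsubspace_carrier[OF sub]] assms(2) card_carrier_bvec by simp
  then show ?thesis using assms(1) by (simp add: matroid_def)
qed

lemma ex_critical_subspace:
  assumes "0\<^sub>v (mrank M) \<notin> edges M"
  shows "\<exists>U. bsubspace (mrank M) U \<and> card U * 2 ^ critical_number M = 2 ^ mrank M \<and> U \<inter> edges M = {}"
proof -
  let ?P = "\<lambda>k. \<exists>U. subspace_codim (mrank M) U k \<and> U \<inter> edges M = {}"
  have "?P (mrank M)"
    using assms bsubspace_singleton_zero
    by (intro exI[of _ "{0\<^sub>v (mrank M)}"]) (auto simp: subspace_codim_iff)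
  then have "?P (critical_number M)" unfolding critical_number_def by (rule LeastI)
  then show ?thesis by (auto simp: subspace_codim_iff)
qed

lemma critical_number_le:
  assumes "bsubspace (mrank M) U" "card U * 2 ^ k = 2 ^ mrank M" "U \<inter> edges M = {}"
  shows "critical_number M \<le> k"
  unfolding critical_number_def using assms by (intro Least_le) (auto simp: subspace_codim_iff)

text \<open>The image of an embedding together with zero is the subspace \<open>F\<close>;
  conversely, coordinates on \<open>F\<close> are an embedding.\<close>

lemma contains_PG_iff:
  "contains M (PG s) \<longleftrightarrow>
     (\<exists>F. bsubspace (mrank M) F \<and> card F = 2 ^ (s + 1) \<and> F - {0\<^sub>v (mrank M)} \<subseteq> edges M)"
    (is "?L \<longleftrightarrow> ?R")
proof
  assume ?L
  then obtain f where f: "additive_map (s + 1) (mrank M) f" "inj_on f (carrier_vec (s + 1))"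
    "f ` (carrier_vec (s + 1) - {0\<^sub>v (s + 1)}) \<subseteq> edges M"
    by (auto simp: contains_def PG_def linear_map_iff_additive)
  have "f ` carrier_vec (s + 1) - {0\<^sub>v (mrank M)} \<subseteq> edges M"
    using f(3) additive_map_zero[OF f(1)] by auto
  then show ?R
    using additive_map_image_bsubspace[OF f(1) bsubspace_UNIV] card_image[OF f(2)] card_carrier_bvec by metis
next
  assume ?R
  then obtain F where F: "bsubspace (mrank M) F" "card F = 2 ^ (s + 1)" "F - {0\<^sub>v (mrank M)} \<subseteq> edges M"
    by blast
  obtain f where f: "additive_map (s + 1) (mrank M) f" "bij_betw f (carrier_vec (s + 1)) F"
    using bsubspace_coordinates[OF F(1,2)] by blast
  have "f x \<noteq> 0\<^sub>v (mrank M)" if "x \<in> carrier_vec (s + 1)" "x \<noteq> 0\<^sub>v (s + 1)" for x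
    using that f additive_map_zero[OF f(1)]
    by (metis bij_betw_def inj_onD zero_carrier_vec)
  then have "f ` (carrier_vec (s + 1) - {0\<^sub>v (s + 1)}) \<subseteq> edges M"
    using f(2) F(3) by (fastforce simp: bij_betw_def)
  then show ?L
    using f by (auto simp: contains_def PG_def linear_map_iff_additive bij_betw_def)
qed

section \<open>Sizes of intersections\<close>

lemma adjoin_Int:
  assumes "bsubspace n T" "S \<subseteq> carrier_vec n" "p \<in> T"
  shows "adjoin p S \<inter> T = adjoin p (S \<inter> T)"
  using bsubspace_add_iff[OF assms(1,3)] assms(2) by (auto simp: adjoin_def)

lemma bsubspace_eq_adjoin:
  assumes "bsubspace n S" "bsubspace n T" "S \<subseteq> T" "card T \<le> 2 * card S" "p \<in> T" "p \<notin> S"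
  shows "T = adjoin p S"
proof -
  have pc: "p \<in> carrier_vec n" using assms bsubspace_carrier by blast
  have "card T < 2 * card (adjoin p S)"
    using card_adjoin[OF assms(1) pc assms(6)] assms(4) bsubspace_card_pos[OF assms(1)] by linarith
  then show ?thesis
    using bsubspace_eqI[OF bsubspace_adjoin[OF assms(1) pc] assms(2) adjoin_subset[OF assms(2,3,5)]] by simp
qed

text \<open>If \<open>q\<close> lies in \<open>Q\<close> but not in \<open>P\<close>, then
  \<open>T\<close> consists of \<open>P\<close> and \<open>q + P\<close>, and the modular law makes
  \<open>Q\<close> a union of two cosets of \<open>P \<inter> Q\<close>.\<close>

lemma bsubspace_index_two_Int:
  assumes P: "bsubspace n P" and Q: "bsubspace n Q" and T: "bsubspace n T"
    and sub: "P \<subseteq> T" "Q \<subseteq> T" "card T \<le> 2 * card P"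
  shows "card Q \<le> 2 * card (P \<inter> Q)"
proof (cases "Q \<subseteq> P")
  case True
  then have "P \<inter> Q = Q" by blast
  then show ?thesis by simp
next
  case False
  then obtain q where q: "q \<in> Q" "q \<notin> P" by blast
  have qc: "q \<in> carrier_vec n" using q bsubspace_carrier[OF Q] by blast
  have "T = adjoin q P" using bsubspace_eq_adjoin[OF P T sub(1,3)] q sub(2) by blast
  then have "Q = adjoin q (P \<inter> Q)"
    using adjoin_Int[OF Q bsubspace_carrier[OF P] q(1)] sub(2) by blast
  then show ?thesis
    using card_adjoin[OF bsubspace_Int[OF P Q] qc] q by (metis IntE order_refl)
qed

text \<open>Sizes are powers of two. Multiplying instead of dividing \<open>2 ^ m\<close> covers
  \<open>m < 2\<close> as well.\<close>

lemma bsubspace_card_trichotomy: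
  assumes "bsubspace n S"
  shows "2 ^ m \<le> card S \<or> 2 * card S = 2 ^ m \<or> 4 * card S \<le> 2 ^ m"
proof -
  obtain k where k: "card S = 2 ^ k" using bsubspace_card_power[OF assms] by blast
  consider "m \<le> k" | "m = Suc k" | d where "m = k + 2 + d"
    by (cases "m \<le> k + 1") (use nat_le_iff_add[of "k + 2" m] in force)+
  then show ?thesis
  proof cases
    case 3
    then show ?thesis using k by (simp add: power_add)
  qed (use k in auto)
qed

text \<open>The inequality is the nonnegativity of \<open>\<Sum>x\<in>A. (g x - 3)\<^sup>2\<close>, where \<open>g x\<close> is
  the number of members of the family through \<open>x\<close>.\<close>
lemma card_almost_disjoint_family_le:
  fixes u :: nat
  assumes A: "finite A" "card A < 3 * u" and G: "finite G"
    and big: "\<And>X. X \<in> G \<Longrightarrow> u \<le> card (A \<inter> X)"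
    and small: "\<And>X Y. X \<in> G \<Longrightarrow> Y \<in> G \<Longrightarrow> X \<noteq> Y \<Longrightarrow> 4 * card (A \<inter> X \<inter> Y) \<le> u"
  shows "card G \<le> 8"
proof (rule ccontr)
  assume "\<not> card G \<le> 8"
  \<comment> \<open>With nine sets the average of \<open>g\<close> over \<open>A\<close> exceeds
    9u/3u = 3, which is why the squares are centred at 3.\<close>
  then obtain F where F: "F \<subseteq> G" "card F = 9" "finite F"
    using obtain_subset_with_card_n[of 9 G] by force
  define g :: "'a \<Rightarrow> int" where "g x = (\<Sum>X\<in>F. of_bool (x \<in> X))" for x
  define S where "S = (\<Sum>X\<in>F. int (card (A \<inter> X)))"
  have card_eq: "int (card (A \<inter> X)) = (\<Sum>x\<in>A. of_bool (x \<in> X))" for X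
    using A(1) by (simp add: Int_def)
  have sum_g: "(\<Sum>x\<in>A. g x) = S"
    unfolding g_def S_def card_eq by (rule sum.swap)
  have "(\<Sum>x\<in>A. g x ^ 2) = (\<Sum>x\<in>A. \<Sum>X\<in>F. \<Sum>Y\<in>F. of_bool (x \<in> X \<inter> Y))"
    unfolding g_def power2_eq_square sum_product by (intro sum.cong) auto
  also have "\<dots> = (\<Sum>X\<in>F. \<Sum>x\<in>A. \<Sum>Y\<in>F. of_bool (x \<in> X \<inter> Y))"
    by (rule sum.swap)
  also have "\<dots> = (\<Sum>X\<in>F. \<Sum>Y\<in>F. int (card (A \<inter> (X \<inter> Y))))"
    unfolding card_eq by (intro sum.cong refl sum.swap)
  also have "4 * \<dots> \<le> (\<Sum>X\<in>F. 4 * int (card (A \<inter> X)) + 8 * int u)"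
    unfolding sum_distrib_left
  proof (rule sum_mono)
    fix X assume X: "X \<in> F"
    have "(\<Sum>Y\<in>F. 4 * int (card (A \<inter> (X \<inter> Y))))
        = 4 * int (card (A \<inter> X)) + (\<Sum>Y\<in>F - {X}. 4 * int (card (A \<inter> (X \<inter> Y))))"
      using X F(3) by (simp add: sum.remove)
    also have "(\<Sum>Y\<in>F - {X}. 4 * int (card (A \<inter> (X \<inter> Y)))) \<le> (\<Sum>Y\<in>F - {X}. int u)"
    proof (rule sum_mono)
      fix Y assume "Y \<in> F - {X}"
      then have "4 * card (A \<inter> X \<inter> Y) \<le> u" using small X F(1) by blast
      then show "4 * int (card (A \<inter> (X \<inter> Y))) \<le> int u" by (simp add: Int_assoc)
    qed
    also have "\<dots> = 8 * int u" using X F by simp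
    finally show "(\<Sum>Y\<in>F. 4 * int (card (A \<inter> (X \<inter> Y)))) \<le> 4 * int (card (A \<inter> X)) + 8 * int u"
      by simp
  qed
  also have "\<dots> = 4 * S + 72 * int u"
    using F(2) by (simp add: S_def sum.distrib sum_distrib_left)
  finally have sq: "4 * (\<Sum>x\<in>A. g x ^ 2) \<le> 4 * S + 72 * int u" by simp
  have "0 \<le> (\<Sum>x\<in>A. (g x - 3) ^ 2)" by (intro sum_nonneg) simp
  also have "\<dots> = (\<Sum>x\<in>A. g x ^ 2 - 6 * g x + 9)"
    by (intro sum.cong) (auto simp: power2_eq_square algebra_simps)
  also have "\<dots> = (\<Sum>x\<in>A. g x ^ 2) - 6 * S + 9 * int (card A)"
    by (simp add: sum.distrib sum_subtractf sum_distrib_left[symmetric] sum_g)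
  finally have "0 \<le> (\<Sum>x\<in>A. g x ^ 2) - 6 * S + 9 * int (card A)" .
  moreover have "9 * int u \<le> S"
  proof -
    have "(\<Sum>X\<in>F. int u) \<le> S" unfolding S_def using big F(1) by (intro sum_mono) auto
    then show ?thesis using F(2) by simp
  qed
  \<comment> \<open>The sum of squares is at most 18u - 5S + 9 \<open>card A\<close>, which is less
    than 18u - 45u + 27u = 0.\<close>
  ultimately show False using sq A(2) by linarith
qed

subsection \<open>The counting argument\<close>

text \<open>A counterexample with the matroid language removed; u is \<open>2 ^ m\<close>. The
  assumption \<open>not_subset_A\<close> reflects a critical number above 5.\<close>

locale dense_config =
  fixes n m :: nat and A E :: "bit vec set"
  assumes n_eq: "n = m + 5"
    and A_eq: "A = carrier_vec n - E"
    and E_carrier: "E \<subseteq> carrier_vec n"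
    and card_A: "card A < 3 * 2 ^ m"
    and hyperplane: "\<And>H. bsubspace n H \<Longrightarrow> card H = 2 ^ (m + 4) \<Longrightarrow> 2 ^ m \<le> card (A - H)"
    and not_subset_A: "\<And>Y. bsubspace n Y \<Longrightarrow> card Y = 2 ^ m \<Longrightarrow> \<not> Y \<subseteq> A"
begin

text \<open>These are the \<open>W\<^sub>e\<close> of the overview: for nonzero \<open>e\<close> the
  cosets of {0, e} split \<open>W\<close> into pairs, and \<open>A\<close> meets every pair.\<close>

definition witness :: "bit vec \<Rightarrow> bit vec set \<Rightarrow> bool" where
  "witness e W \<longleftrightarrow> bsubspace n W \<and> card W = 2 ^ (m + 1) \<and> e \<in> W \<and> (\<forall>w\<in>W. w \<in> A \<or> e + w \<in> A)"

lemma finite_A: "finite A"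
  using A_eq finite_carrier_bvec by simp

lemma witness_card_Int:
  assumes "witness e W"
  shows "2 ^ m \<le> card (A \<inter> W)"
proof -
  have W: "bsubspace n W" "card W = 2 ^ (m + 1)" "e \<in> W" "\<And>w. w \<in> W \<Longrightarrow> w \<in> A \<or> e + w \<in> A"
    using assms by (auto simp: witness_def)
  have ec: "e \<in> carrier_vec n" using W bsubspace_carrier by blast
  have "W \<subseteq> (A \<inter> W) \<union> (+) e ` (A \<inter> W)"
  proof
    fix w assume w: "w \<in> W"
    have "e + (e + w) = w" using ec w bsubspace_carrier[OF W(1)] by (auto intro: bvec_add_cancel)
    then show "w \<in> (A \<inter> W) \<union> (+) e ` (A \<inter> W)"
      using W(4)[OF w] bsubspace_add[OF W(1) W(3) w] w by (metis IntI UnI1 UnI2 imageI)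
  qed
  then have "card W \<le> card (A \<inter> W) + card ((+) e ` (A \<inter> W))"
    using card_mono[of "(A \<inter> W) \<union> (+) e ` (A \<inter> W)" W] finite_A card_Un_le order_trans by blast
  also have "\<dots> \<le> card (A \<inter> W) + card (A \<inter> W)"
    using card_image_le finite_A by (intro add_left_mono) blast
  finally show ?thesis using W(2) by simp
qed

text \<open>The three hyperplanes through \<open>K\<close> cover the space. Summing |A - K| = |A -
  H| + |A \<inter> H - K| over them gives 3|A - K| \<ge> 3u + |A - K|.\<close>

lemma codim_two_bound:
  assumes K: "bsubspace n K" "card K = 2 ^ (m + 3)"
  shows "3 * 2 ^ m \<le> 2 * card (A - K)"
proof -
  have cV: "card (carrier_vec n :: bit vec set) = 32 * 2 ^ m"
    using card_carrier_bvec n_eq by (simp add: power_add)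
  have "K \<noteq> carrier_vec n" using K(2) cV by (auto simp: power_add)
  then obtain p where p: "p \<in> carrier_vec n" "p \<notin> K" using bsubspace_carrier[OF K(1)] by blast
  let ?H1 = "adjoin p K"
  have H1: "bsubspace n ?H1" "card ?H1 = 2 ^ (m + 4)"
    using bsubspace_adjoin[OF K(1) p(1)] card_adjoin[OF K(1) p] K(2) by (auto simp: power_add)
  have "?H1 \<noteq> carrier_vec n" using H1(2) cV by (auto simp: power_add)
  then obtain q where q: "q \<in> carrier_vec n" "q \<notin> ?H1" using bsubspace_carrier[OF H1(1)] by blast
  have qK: "q \<notin> K" using q(2) adjoin_superset by blast
  let ?H2 = "adjoin q K"
  have H2: "bsubspace n ?H2" "card ?H2 = 2 ^ (m + 4)"
    using bsubspace_adjoin[OF K(1) q(1)] card_adjoin[OF K(1) q(1) qK] K(2) by (auto simp: power_add)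
  have pq: "p + q \<in> carrier_vec n" using p q by simp
  have pqK: "p + q \<notin> K"
  proof
    assume "p + q \<in> K"
    then have "p + (p + q) \<in> ?H1" by (auto simp: adjoin_def)
    then show False using q(2) bvec_add_cancel[OF p(1) q(1)] by simp
  qed
  let ?H3 = "adjoin (p + q) K"
  have H3: "bsubspace n ?H3" "card ?H3 = 2 ^ (m + 4)"
    using bsubspace_adjoin[OF K(1) pq] card_adjoin[OF K(1) pq pqK] K(2) by (auto simp: power_add)
  have "carrier_vec n = adjoin q ?H1"
    using bsubspace_eq_adjoin[OF H1(1) bsubspace_UNIV bsubspace_carrier[OF H1(1)] _ q] H1(2) cV
    by (simp add: power_add)
  moreover have "q + (p + z) = (p + q) + z" if "z \<in> K" for z
  proof -
    have "z \<in> carrier_vec n" using that bsubspace_carrier[OF K(1)] by blast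
    then show ?thesis
      using assoc_add_vec[OF q(1) p(1)] comm_add_vec[OF q(1) p(1)] by simp
  qed
  ultimately have cover: "carrier_vec n \<subseteq> ?H1 \<union> ?H2 \<union> ?H3"
    by (auto simp: adjoin_def)
  have split: "card (A - K) = card (A - H) + card (A \<inter> H - K)" if "K \<subseteq> H" for H
  proof -
    have "A - K = (A - H) \<union> (A \<inter> H - K)" using that by blast
    then show ?thesis using finite_A by (simp add: card_Un_disjoint Int_def disjoint_iff)
  qed
  have "card (A - K) \<le> card ((A \<inter> ?H1 - K) \<union> (A \<inter> ?H2 - K) \<union> (A \<inter> ?H3 - K))"
    using cover A_eq finite_A by (intro card_mono) auto
  also have "\<dots> \<le> card (A \<inter> ?H1 - K) + card (A \<inter> ?H2 - K) + card (A \<inter> ?H3 - K)"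
    by (rule order_trans[OF card_Un_le add_right_mono[OF card_Un_le]])
  finally show ?thesis
    using split[OF adjoin_superset[of K p]] split[OF adjoin_superset[of K q]]
      split[OF adjoin_superset[of K "p + q"]] hyperplane[OF H1] hyperplane[OF H2] hyperplane[OF H3]
    by linarith
qed

text \<open>Otherwise \<open>W\<close> and \<open>U\<close> would span a subspace \<open>K\<close>
  of codimension 2, and \<open>A\<close> would be too large: much of it lies in \<open>W\<close>, in
  \<open>U - W\<close> and outside \<open>K\<close>.\<close>

lemma witness_Int_not_half:
  assumes "witness e W" "witness f U"
  shows "2 * card (W \<inter> U) \<noteq> 2 ^ m"
proof
  assume I: "2 * card (W \<inter> U) = 2 ^ m"
  have W: "bsubspace n W" "card W = 2 * 2 ^ m" and U: "bsubspace n U" "card U = 2 * 2 ^ m"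
    using assms by (auto simp: witness_def)
  note bI = bsubspace_Int[OF W(1) U(1)]
  have "\<not> U \<subseteq> W" using I U(2) by (auto simp: Int_absorb1)
  then obtain p where p: "p \<in> U" "p \<notin> W" by blast
  have pc: "p \<in> carrier_vec n" using p(1) bsubspace_carrier[OF U(1)] by blast
  \<comment> \<open>\<open>U\<close> has index 4 over \<open>W \<inter> U\<close>, so two vectors
    \<open>p\<close> and \<open>q\<close> of \<open>U\<close> suffice to reach a subspace of size 8u
    containing both.\<close>
  let ?W1 = "adjoin p W"
  have W1: "bsubspace n ?W1" "card ?W1 = 4 * 2 ^ m"
    using bsubspace_adjoin[OF W(1) pc] card_adjoin[OF W(1) pc p(2)] W(2) by auto
  have I1: "card (?W1 \<inter> U) = 2 ^ m"
    using adjoin_Int[OF U(1) bsubspace_carrier[OF W(1)] p(1)] card_adjoin[OF bI pc] p I by simp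
  then have "\<not> U \<subseteq> ?W1" using U(2) by (auto simp: Int_absorb1)
  then obtain q where q: "q \<in> U" "q \<notin> ?W1" by blast
  have qc: "q \<in> carrier_vec n" using q(1) bsubspace_carrier[OF U(1)] by blast
  let ?K = "adjoin q ?W1"
  have K: "bsubspace n ?K" "card ?K = 2 ^ (m + 3)"
    using bsubspace_adjoin[OF W1(1) qc] card_adjoin[OF W1(1) qc q(2)] W1(2) by (auto simp: power_add)
  have "card (?K \<inter> U) = card U"
    using adjoin_Int[OF U(1) bsubspace_carrier[OF W1(1)] q(1)]
      card_adjoin[OF bsubspace_Int[OF W1(1) U(1)] qc] q I1 U(2) by simp
  then have UK: "U \<subseteq> ?K"
    using card_subset_eq[OF bsubspace_finite[OF U(1)], of "?K \<inter> U"] by blast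
  have WK: "W \<subseteq> ?K" using adjoin_superset by blast
  have "card (A \<inter> U) \<le> card ((A \<inter> ?K - W) \<union> (W \<inter> U))"
    using UK finite_A bsubspace_finite[OF bI] by (intro card_mono) auto
  also have "\<dots> \<le> card (A \<inter> ?K - W) + card (W \<inter> U)" by (rule card_Un_le)
  finally have 1: "2 ^ m \<le> card (A \<inter> ?K - W) + card (W \<inter> U)"
    using witness_card_Int[OF assms(2)] by linarith
  \<comment> \<open>The three disjoint pieces have at least u, u/2 and 3u/2 elements, against
    \<open>card A\<close> < 3u.\<close>
  have "A = (A \<inter> W) \<union> ((A \<inter> ?K - W) \<union> (A - ?K))" using WK by blast
  moreover have "card ((A \<inter> W) \<union> ((A \<inter> ?K - W) \<union> (A - ?K)))
      = card (A \<inter> W) + (card (A \<inter> ?K - W) + card (A - ?K))"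
    using finite_A WK by (subst card_Un_disjoint; (subst card_Un_disjoint)?) auto
  ultimately have "card A = card (A \<inter> W) + (card (A \<inter> ?K - W) + card (A - ?K))" by simp
  then show False
    using 1 I witness_card_Int[OF assms(1)] codim_two_bound[OF K] card_A by linarith
qed

text \<open>The dichotomy is that of pairwise intersecting lines, which all pass through one point
  or all lie in one plane; here \<open>Y\<close> is the point and \<open>Z\<close> the
  plane.\<close>

lemma card_class_le:
  assumes W: "\<And>e. e \<in> E \<Longrightarrow> witness e (W e)" and e0: "e0 \<in> E"
  shows "card {e \<in> E. 2 ^ m \<le> card (W e \<inter> W e0)} \<le> 3 * 2 ^ m"
proof -
  define C where "C = {e \<in> E. 2 ^ m \<le> card (W e \<inter> W e0)}"
  have Wb: "bsubspace n (W e)" "card (W e) = 2 * 2 ^ m" "e \<in> W e" if "e \<in> C" for e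
    using W[of e] that by (auto simp: witness_def C_def)
  have e0C: "e0 \<in> C" using W[OF e0] e0 by (auto simp: witness_def C_def)
  have CE: "C \<subseteq> E" by (auto simp: C_def)
  \<comment> \<open>Inside \<open>W e0\<close> both \<open>?P\<close> and \<open>?Q\<close> have
    index at most 2, so they share at least u/2 vectors. Exactly u/2 is excluded for
    \<open>W e \<inter> W f\<close>, and the next power of two is u.\<close>
  have meet: "2 ^ m \<le> card (W e \<inter> W f)" if "e \<in> C" "f \<in> C" for e f
  proof -
    let ?P = "W e \<inter> W e0" and ?Q = "W f \<inter> W e0"
    have b: "bsubspace n ?P" "bsubspace n ?Q" using bsubspace_Int Wb that e0C by auto
    have "card ?Q \<le> 2 * card (?P \<inter> ?Q)"
      using bsubspace_index_two_Int[OF b Wb(1)[OF e0C]] Wb(2)[OF e0C] that(1) by (auto simp: C_def)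
    also have "\<dots> \<le> 2 * card (W e \<inter> W f)"
      using bsubspace_finite[OF Wb(1)[OF that(1)]] by (intro mult_left_mono card_mono) auto
    finally have "2 ^ m \<le> 2 * card (W e \<inter> W f)" using that(2) by (auto simp: C_def)
    moreover have "(2 :: nat) ^ m > 0" by simp
    moreover have "2 * card (W e \<inter> W f) \<noteq> 2 ^ m"
      using witness_Int_not_half[OF W W] that by (auto simp: C_def)
    ultimately show ?thesis
      using bsubspace_card_trichotomy[OF bsubspace_Int[OF Wb(1)[OF that(1)] Wb(1)[OF that(2)]], of m]
      by linarith
  qed
  have "card C \<le> 3 * 2 ^ m"
  proof (cases "\<exists>Y. bsubspace n Y \<and> card Y = 2 ^ m \<and> (\<forall>e\<in>C. Y \<subseteq> W e)")
    case True
    then obtain Y where Y: "bsubspace n Y" "card Y = 2 ^ m" "\<And>e. e \<in> C \<Longrightarrow> Y \<subseteq> W e" by blast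
    obtain g where g: "g \<in> Y" "g \<notin> A" using not_subset_A[OF Y(1,2)] by blast
    have gc: "g \<in> carrier_vec n" using g(1) bsubspace_carrier[OF Y(1)] by blast
    \<comment> \<open>Since \<open>g\<close> lies in \<open>W e\<close> but not in \<open>A\<close>,
      its partner \<open>e + g\<close> is in \<open>A\<close>; translation by \<open>g\<close> thus
      embeds \<open>C\<close> into \<open>A\<close>.\<close>
    have "g + e \<in> A" if "e \<in> C" for e
    proof -
      have "e + g \<in> A" using W[of e] that Y(3)[OF that] g CE by (auto simp: witness_def)
      then show ?thesis using comm_add_vec[OF gc, of e] that CE E_carrier by auto
    qed
    then have "(+) g ` C \<subseteq> A" by blast
    then have "card ((+) g ` C) \<le> card A" using card_mono[OF finite_A] by blast
    then show ?thesis using card_bvec_translate[OF gc, of C] CE E_carrier card_A by simp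
  next
    case noY: False
    obtain Y0 where Y0: "bsubspace n Y0" "Y0 \<subseteq> W e0" "card Y0 = 2 ^ m"
      using bsubspace_between[OF bsubspace_singleton_zero Wb(1)[OF e0C], of m] Wb(2)[OF e0C]
        bsubspace_zero[OF Wb(1)[OF e0C]] by auto
    \<comment> \<open>If every member equalled \<open>W e0\<close>, the subspace \<open>Y0\<close>
      would be common to all.\<close>
    then obtain e1 where e1: "e1 \<in> C" "W e1 \<noteq> W e0" using noY by metis
    let ?Y = "W e0 \<inter> W e1"
    have bY: "bsubspace n ?Y" using bsubspace_Int Wb(1) e0C e1(1) by blast
    have "?Y \<noteq> W e0"
    proof
      assume "?Y = W e0"
      then have "W e0 \<subseteq> W e1" by blast
      then have "W e0 = W e1"
        using card_subset_eq[OF bsubspace_finite[OF Wb(1)[OF e1(1)]]] Wb(2) e0C e1(1) by metis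
      then show False using e1(2) by simp
    qed
    then have "2 * card ?Y \<le> card (W e0)"
      by (intro bsubspace_proper_card[OF bY Wb(1)[OF e0C]]) auto
    then have cY: "card ?Y = 2 ^ m" using meet[OF e0C e1(1)] Wb(2)[OF e0C] by simp
    then obtain e2 where e2: "e2 \<in> C" "\<not> ?Y \<subseteq> W e2" using noY bY by blast
    obtain p where p: "p \<in> W e1" "p \<notin> W e0"
      using e1 Wb(2)[OF e0C] Wb(2)[OF e1(1)] card_subset_eq[OF bsubspace_finite[OF Wb(1)[OF e0C]], of "W e1"]
      by auto
    have pc: "p \<in> carrier_vec n" using p(1) bsubspace_carrier[OF Wb(1)[OF e1(1)]] by blast
    define Z where "Z = adjoin p (W e0)"
    have Z: "bsubspace n Z" "card Z = 4 * 2 ^ m" "W e0 \<subseteq> Z"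
      using bsubspace_adjoin[OF Wb(1)[OF e0C] pc] card_adjoin[OF Wb(1)[OF e0C] pc p(2)] Wb(2)[OF e0C]
      by (auto simp: Z_def adjoin_def)
    have "W e1 = adjoin p ?Y"
      using bsubspace_eq_adjoin[OF bY Wb(1)[OF e1(1)] _ _ p(1)] p(2) cY Wb(2)[OF e1(1)] by simp
    also have "\<dots> \<subseteq> Z" unfolding Z_def by (rule adjoin_mono) blast
    finally have W1Z: "W e1 \<subseteq> Z" .
    \<comment> \<open>\<open>R\<close> and \<open>S\<close> together fill at least 3u/2 of
      \<open>W f \<inter> Z\<close>, more than half of \<open>W f\<close>.\<close>
    have gen: "W f \<subseteq> Z"
      if f: "f \<in> C" and RS: "R \<subseteq> W f \<inter> Z" "S \<subseteq> W f \<inter> Z" "2 ^ m \<le> card R" "2 ^ m \<le> card S"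
        and small: "2 * card (R \<inter> S) \<le> 2 ^ m" for f R S
    proof -
      have fin: "finite (W f \<inter> Z)" using bsubspace_finite[OF Z(1)] by simp
      have "card R + card S = card (R \<union> S) + card (R \<inter> S)"
        using RS(1,2) fin finite_subset by (intro card_Un_Int) blast+
      moreover have "card (R \<union> S) \<le> card (W f \<inter> Z)"
        using RS(1,2) fin by (intro card_mono) auto
      moreover have "(2 :: nat) ^ m > 0" by simp
      ultimately have "card (W f) < 2 * card (W f \<inter> Z)"
        using small RS(3,4) Wb(2)[OF f] by linarith
      then have "W f \<inter> Z = W f"
        by (intro bsubspace_eqI[OF bsubspace_Int[OF Wb(1)[OF f] Z(1)] Wb(1)[OF f]]) auto
      then show ?thesis by blast
    qed
    have half: "2 * card (?Y \<inter> W f) \<le> 2 ^ m" if "f \<in> C" "\<not> ?Y \<subseteq> W f" for f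
    proof -
      have "2 * card (?Y \<inter> W f) \<le> card ?Y"
        using that by (intro bsubspace_proper_card[OF bsubspace_Int[OF bY Wb(1)[OF that(1)]] bY]) auto
      then show ?thesis using cY by simp
    qed
    have sub1: "W f \<subseteq> Z" if "f \<in> C" "\<not> ?Y \<subseteq> W f" for f
    proof (rule gen[OF that(1), of "W f \<inter> W e0" "W f \<inter> W e1"])
      have "(W f \<inter> W e0) \<inter> (W f \<inter> W e1) = ?Y \<inter> W f" by blast
      then show "2 * card ((W f \<inter> W e0) \<inter> (W f \<inter> W e1)) \<le> 2 ^ m"
        using half[OF that] by simp
    qed (use meet that e0C e1 Z W1Z in auto)
    \<comment> \<open>When \<open>W f\<close> contains \<open>?Y\<close>, the third subspace
      \<open>W e2\<close> helps: it lies in \<open>Z\<close> by \<open>sub1\<close> and meets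
      \<open>?Y\<close> in at most u/2.\<close>
    have sub: "W f \<subseteq> Z" if f: "f \<in> C" for f
    proof (cases "?Y \<subseteq> W f")
      case True
      show ?thesis
      proof (rule gen[OF f, of "W f \<inter> W e2" ?Y])
        have "(W f \<inter> W e2) \<inter> ?Y = ?Y \<inter> W e2" using True by blast
        then show "2 * card ((W f \<inter> W e2) \<inter> ?Y) \<le> 2 ^ m" using half[OF e2] by simp
      qed (use meet[OF f e2(1)] sub1[OF e2] True cY Z in auto)
    qed (use sub1 f in blast)
    have "C \<subseteq> Z - A" using sub Wb(3) CE A_eq by blast
    then have "card C \<le> card (Z - A)" using bsubspace_finite[OF Z(1)] by (intro card_mono) auto
    also have "\<dots> = card Z - card (A \<inter> Z)"
      using bsubspace_finite[OF Z(1)] by (simp add: card_Diff_subset_Int Int_commute)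
    also have "card (A \<inter> W e0) \<le> card (A \<inter> Z)" using Z(3) finite_A by (intro card_mono) auto
    then have "card Z - card (A \<inter> Z) \<le> 3 * 2 ^ m"
      using witness_card_Int[OF W[OF e0]] Z(2) by linarith
    finally show ?thesis .
  qed
  then show ?thesis by (simp add: C_def)
qed

text \<open>A largest family of witnesses pairwise sharing at most u/4 has at most 8 members. By
  maximality each \<open>W e\<close> shares at least u with some member, so at most 8 classes of at
  most 3u vectors cover \<open>E\<close>.\<close>

lemma some_without_witness: "\<exists>e\<in>E. \<forall>W. \<not> witness e W"
proof (rule ccontr)
  assume "\<not> (\<exists>e\<in>E. \<forall>W. \<not> witness e W)"
  then obtain W where W: "\<And>e. e \<in> E \<Longrightarrow> witness e (W e)" by metis
  have finE: "finite E" using E_carrier finite_carrier_bvec finite_subset by blast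
  define P where "P G \<longleftrightarrow> G \<subseteq> W ` E \<and> (\<forall>X\<in>G. \<forall>Y\<in>G. X \<noteq> Y \<longrightarrow> 4 * card (X \<inter> Y) \<le> 2 ^ m)" for G
  have P8: "card G \<le> 8" if G: "P G" for G
  proof (rule card_almost_disjoint_family_le[OF finite_A card_A])
    show "finite G" using G finE finite_subset[of G "W ` E"] unfolding P_def by simp
    show "2 ^ m \<le> card (A \<inter> X)" if "X \<in> G" for X
      using that G W witness_card_Int unfolding P_def by blast
    fix X Y assume XY: "X \<in> G" "Y \<in> G" "X \<noteq> Y"
    have "finite X" using XY(1) G W bsubspace_finite unfolding P_def witness_def by blast
    then have "card (A \<inter> X \<inter> Y) \<le> card (X \<inter> Y)" by (intro card_mono) auto
    moreover have "4 * card (X \<inter> Y) \<le> 2 ^ m" using G XY unfolding P_def by blast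
    ultimately show "4 * card (A \<inter> X \<inter> Y) \<le> 2 ^ m" by linarith
  qed
  have "P {}" by (simp add: P_def)
  moreover have "\<forall>G. P G \<longrightarrow> card G < 9" using P8 by force
  ultimately obtain G where G: "P G" "\<And>F. P F \<Longrightarrow> card F \<le> card G"
    using ex_has_greatest_nat[of P "{}" card 9] by auto
  have finG: "finite G" using G(1) finE finite_subset[of G "W ` E"] unfolding P_def by simp
  have cover: "\<exists>X\<in>G. 2 ^ m \<le> card (W e \<inter> X)" if e: "e \<in> E" for e
  proof (rule ccontr)
    assume neg: "\<not> (\<exists>X\<in>G. 2 ^ m \<le> card (W e \<inter> X))"
    have "card (W e) = 2 ^ (m + 1)" using W[OF e] by (simp add: witness_def)
    then have "W e \<notin> G" using neg by auto
    have small: "4 * card (W e \<inter> X) \<le> 2 ^ m" if X: "X \<in> G" for X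
    proof -
      obtain f where f: "f \<in> E" "X = W f" using X G(1) unfolding P_def by blast
      have "bsubspace n (W e \<inter> X)" using W[OF e] W[OF f(1)] f(2) bsubspace_Int by (simp add: witness_def)
      then show ?thesis
        using bsubspace_card_trichotomy[of n "W e \<inter> X" m] neg X witness_Int_not_half[OF W[OF e] W[OF f(1)]]
          f(2) by blast
    qed
    have "P (insert (W e) G)"
      using G(1) small e unfolding P_def by (auto simp: Int_commute)
    then have "card (insert (W e) G) \<le> card G" by (rule G(2))
    then show False using \<open>W e \<notin> G\<close> finG by simp
  qed
  have "E \<subseteq> (\<Union>X\<in>G. {e \<in> E. 2 ^ m \<le> card (W e \<inter> X)})" using cover by blast
  then have "card E \<le> card (\<Union>X\<in>G. {e \<in> E. 2 ^ m \<le> card (W e \<inter> X)})"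
    using finE finG by (intro card_mono) auto
  also have "\<dots> \<le> (\<Sum>X\<in>G. card {e \<in> E. 2 ^ m \<le> card (W e \<inter> X)})"
    by (rule card_UN_le[OF finG])
  also have "\<dots> \<le> (\<Sum>X\<in>G. 3 * 2 ^ m)"
    using G(1) card_class_le[OF W] unfolding P_def by (intro sum_mono) blast
  also have "\<dots> \<le> 24 * 2 ^ m" using P8[OF G(1)] by simp
  finally have "card E \<le> 24 * 2 ^ m" .
  moreover have "card A = card (carrier_vec n :: bit vec set) - card E"
    unfolding A_eq using E_carrier finE by (rule card_Diff_subset[rotated])
  moreover have "card (carrier_vec n :: bit vec set) = 32 * 2 ^ m"
    using card_carrier_bvec n_eq by (simp add: power_add)
  moreover have "(2 :: nat) ^ m > 0" by simp
  ultimately show False using card_A by linarith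
qed

end

section \<open>Applying the hypothesis inside a subspace\<close>

lemma bsubspace_disjoint_of_PG_free:
  assumes hyp: "\<And>M'. \<lbrakk>matroid M'; free_of (PG 3) M';
      real (msize M') > (1 - 3 / 2 ^ 4) * 2 ^ mrank M'\<rbrakk> \<Longrightarrow> critical_number M' \<in> {3, 4}"
    and H: "bsubspace n H" "card H = 2 ^ k" "4 \<le> k"
    and E: "E \<subseteq> H - {0\<^sub>v n}" "13 * 2 ^ k < 16 * card E"
    and free: "\<And>F. bsubspace n F \<Longrightarrow> F \<subseteq> H \<Longrightarrow> card F = 16 \<Longrightarrow> \<not> F - {0\<^sub>v n} \<subseteq> E"
  shows "\<exists>X. bsubspace n X \<and> X \<subseteq> H \<and> card X * 16 = 2 ^ k \<and> X \<inter> E = {}"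
proof -
  \<comment> \<open>Coordinates on \<open>H\<close> pull \<open>E\<close> back to a matroid of rank
    \<open>k\<close>, to which the hypothesis applies; 13/16 is its density bound.\<close>
  obtain f where f: "additive_map k n f" "bij_betw f (carrier_vec k) H"
    using bsubspace_coordinates[OF H(1,2)] by blast
  have inj: "inj_on f (carrier_vec k)" and im: "f ` carrier_vec k = H"
    using f(2) by (auto simp: bij_betw_def)
  define E' where "E' = {v \<in> carrier_vec k. f v \<in> E}"
  define M where "M = \<lparr>mrank = k, edges = E'\<rparr>"
  have E'c: "E' \<subseteq> carrier_vec k" by (auto simp: E'_def)
  have "f ` E' = E" using im E(1) by (auto simp: E'_def)
  then have card_E': "card E' = card E" using card_image[OF inj_on_subset[OF inj E'c]] by simp
  have zero: "0\<^sub>v k \<notin> E'" using additive_map_zero[OF f(1)] E(1) by (auto simp: E'_def)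
  have "matroid M"
    unfolding M_def using E'c zero E(2) card_E' by (intro matroid_if_dense) auto
  moreover have "free_of (PG 3) M"
  proof (unfold free_of_def, rule notI)
    assume "contains M (PG 3)"
    then obtain F where F: "bsubspace k F" "card F = 16" "F - {0\<^sub>v k} \<subseteq> E'"
      by (auto simp: contains_PG_iff M_def)
    have "card (f ` F) = 16"
      using card_image[OF inj_on_subset[OF inj bsubspace_carrier[OF F(1)]]] F(2) by simp
    moreover have "f ` F - {0\<^sub>v n} \<subseteq> E"
      using F(3) additive_map_zero[OF f(1)] by (auto simp: E'_def)
    moreover have "f ` F \<subseteq> H" using im bsubspace_carrier[OF F(1)] by blast
    ultimately show False using free additive_map_image_bsubspace[OF f(1) F(1)] by blast
  qed
  moreover have "real (msize M) > (1 - 3 / 2 ^ 4) * 2 ^ mrank M"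
  proof -
    have "real (13 * 2 ^ k) < real (16 * card E)" using E(2) of_nat_less_iff by blast
    then show ?thesis by (simp add: M_def msize_def card_E')
  qed
  ultimately have crit: "critical_number M \<le> 4" using hyp by force
  obtain U where U: "bsubspace k U" "card U * 2 ^ critical_number M = 2 ^ k" "U \<inter> E' = {}"
    using ex_critical_subspace[of M] zero by (auto simp: M_def)
  \<comment> \<open>The critical number may be below 4, so \<open>U\<close> is cut down to a
    subspace of codimension exactly 4.\<close>
  have "(2 :: nat) ^ k \<le> card U * 2 ^ 4"
    unfolding U(2)[symmetric] using crit by (intro mult_left_mono power_increasing) auto
  moreover have k: "(2 :: nat) ^ k = 2 ^ (k - 4) * 2 ^ 4"
    using H(3) power_add[of "2 :: nat" "k - 4" 4] by simp
  ultimately have "2 ^ (k - 4) \<le> card U" by simp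
  then obtain T where T: "bsubspace k T" "T \<subseteq> U" "card T = 2 ^ (k - 4)"
    using bsubspace_between[OF bsubspace_singleton_zero U(1), of "k - 4"] bsubspace_zero[OF U(1)] by auto
  have "card (f ` T) * 16 = 2 ^ k"
    using card_image[OF inj_on_subset[OF inj bsubspace_carrier[OF T(1)]]] T(3) k by simp
  moreover have "f ` T \<subseteq> H" using im bsubspace_carrier[OF T(1)] by blast
  moreover have "f ` T \<inter> E = {}"
    using T(2) U(3) bsubspace_carrier[OF T(1)] by (auto simp: E'_def)
  ultimately show ?thesis using additive_map_image_bsubspace[OF f(1) T(1)] by blast
qed

theorem theorem3p4:
  assumes "\<And>M'. \<lbrakk>matroid M'; free_of (PG 3) M';
      real (msize M') > (1 - 3 / 2 ^ 4) * 2 ^ mrank M'\<rbrakk>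
      \<Longrightarrow> critical_number M' \<in> {3, 4}"
  shows "\<not> (\<exists>M. matroid M \<and> free_of (PG 4) M \<and>
      real (msize M) > (1 - 3 / 2 ^ 5) * 2 ^ mrank M \<and>
      critical_number M > 5)"
proof
  assume "\<exists>M. matroid M \<and> free_of (PG 4) M \<and>
      real (msize M) > (1 - 3 / 2 ^ 5) * 2 ^ mrank M \<and> critical_number M > 5"
  then obtain M where M: "matroid M" "free_of (PG 4) M"
    "real (msize M) > (1 - 3 / 2 ^ 5) * 2 ^ mrank M" "critical_number M > 5" by blast
  define n m E A where "n = mrank M" and "m = n - 5" and "E = edges M" and "A = carrier_vec n - E"
  have E: "E \<subseteq> carrier_vec n" "0\<^sub>v n \<notin> E"
    using M(1) by (auto simp: matroid_def n_def E_def)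
  have finE: "finite E" using E(1) finite_carrier_bvec finite_subset by blast
  have finA: "finite A" using finite_carrier_bvec by (simp add: A_def)
  \<comment> \<open>This forces \<open>n > 5\<close>, so the subtraction in \<open>m\<close> is not
    truncated.\<close>
  have "critical_number M \<le> n"
    using critical_number_le[of M "{0\<^sub>v n}" n] bsubspace_singleton_zero E(2) by (simp add: n_def E_def)
  then have n: "n = m + 5" using M(4) by (simp add: m_def)
  have cV: "card (carrier_vec n :: bit vec set) = 32 * 2 ^ m"
    using card_carrier_bvec n by (simp add: power_add)
  have "real (29 * 2 ^ n) < real (32 * card E)"
    using M(3) by (simp add: msize_def E_def n_def)
  then have "29 * 2 ^ n < 32 * card E" using of_nat_less_iff by blast
  then have cE: "29 * 2 ^ m < card E" using n by (simp add: power_add)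
  have "card A + card E = 32 * 2 ^ m"
    using card_Diff_subset[OF finE E(1)] card_mono[OF finite_carrier_bvec E(1)] cV
    by (simp add: A_def)
  then have cA: "card A < 3 * 2 ^ m" using cE by linarith
  have no32: False if "bsubspace n F" "card F = 32" "F - {0\<^sub>v n} \<subseteq> E" for F
    using M(2) that by (auto simp: free_of_def contains_PG_iff n_def E_def)
  \<comment> \<open>Used for \<open>E \<inter> H\<close> and for the set \<open>D\<close> below. As
    \<open>H\<close> has 16u vectors and fewer than 3u are missing from \<open>D\<close>, the
    density exceeds 13/16.\<close>
  have lift: "\<exists>X. bsubspace n X \<and> X \<subseteq> H \<and> card X = 2 ^ m \<and> X \<inter> D = {}"
    if D: "bsubspace n H" "card H = 2 ^ (m + 4)" "D \<subseteq> H - {0\<^sub>v n}" "card (H - D) \<le> card A"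
      "\<And>F. bsubspace n F \<Longrightarrow> F \<subseteq> H \<Longrightarrow> card F = 16 \<Longrightarrow> \<not> F - {0\<^sub>v n} \<subseteq> D" for H D
  proof -
    have "card H = card D + card (H - D)"
      using card_Un_disjoint[of D "H - D"] D(3) bsubspace_finite[OF D(1)] finite_subset[of D H]
      by (auto simp: Un_absorb1 subset_Diff_insert)
    then have dens: "13 * 2 ^ (m + 4) < 16 * card D"
      using D(2,4) cA by (simp add: power_add)
    have "\<exists>X. bsubspace n X \<and> X \<subseteq> H \<and> card X * 16 = 2 ^ (m + 4) \<and> X \<inter> D = {}"
      using assms D(5)
      by (rule bsubspace_disjoint_of_PG_free[OF _ D(1,2) le_add2 D(3) dens])
    then show ?thesis by (simp add: power_add)
  qed
  interpret dense_config n m A E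
  proof
    fix Y assume Y: "bsubspace n Y" "card Y = 2 ^ m"
    show "\<not> Y \<subseteq> A"
    proof
      assume "Y \<subseteq> A"
      then have "critical_number M \<le> 5"
        using Y n by (intro critical_number_le[of M Y]) (auto simp: n_def E_def A_def power_add)
      then show False using M(4) by simp
    qed
  next
    fix H assume H: "bsubspace n H" "card H = 2 ^ (m + 4)"
    have "\<exists>F. bsubspace n F \<and> F \<subseteq> H \<and> card F = 16 \<and> F - {0\<^sub>v n} \<subseteq> E \<inter> H"
    proof (rule ccontr)
      assume none: "\<not> ?thesis"
      have "card (H - E \<inter> H) \<le> card A"
        using bsubspace_carrier[OF H(1)] finA by (intro card_mono) (auto simp: A_def)
      then obtain X where X: "bsubspace n X" "X \<subseteq> H" "card X = 2 ^ m" "X \<inter> (E \<inter> H) = {}"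
        using lift[OF H, of "E \<inter> H"] E(2) none by blast
      then have "X \<subseteq> A" using bsubspace_carrier by (fastforce simp: A_def)
      then have "critical_number M \<le> 5"
        using X n by (intro critical_number_le[of M X]) (auto simp: n_def E_def A_def power_add)
      then show False using M(4) by simp
    qed
    then obtain F where F: "bsubspace n F" "F \<subseteq> H" "card F = 16" "F - {0\<^sub>v n} \<subseteq> E" by blast
    \<comment> \<open>For \<open>p\<close> outside \<open>H\<close> the translate
      \<open>p + F\<close> meets \<open>A\<close>, or else \<open>adjoin p F\<close> would give a
      PG(4,2). So 16u vectors are covered by \<open>card (A - H)\<close> translates of size
      16.\<close>
    have "carrier_vec n - H \<subseteq> (\<Union>a\<in>A - H. (+) a ` F)"
    proof
      fix p assume "p \<in> carrier_vec n - H"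
      then have p: "p \<in> carrier_vec n" "p \<notin> H" by auto
      have "\<exists>x\<in>F. p + x \<in> A"
      proof (rule ccontr)
        assume "\<not> (\<exists>x\<in>F. p + x \<in> A)"
        then have "adjoin p F - {0\<^sub>v n} \<subseteq> E"
          using F(4) p(1) bsubspace_carrier[OF F(1)] by (auto simp: adjoin_def A_def)
        then show False
          using no32 bsubspace_adjoin[OF F(1) p(1)] card_adjoin[OF F(1) p(1)] F(2,3) p(2) by auto
      qed
      then obtain x where x: "x \<in> F" "p + x \<in> A" by blast
      have xc: "x \<in> carrier_vec n" "x \<in> H" using x(1) F(2) bsubspace_carrier[OF F(1)] by auto
      have "x + p \<notin> H" using p bsubspace_add_iff[OF H(1) xc(2) p(1)] by blast
      then have "p + x \<in> A - H" using x(2) comm_add_vec[OF p(1) xc(1)] by simp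
      moreover have "p = (p + x) + x"
        using p(1) xc(1) bvec_add_self[OF xc(1)] by (simp add: assoc_add_vec)
      ultimately show "p \<in> (\<Union>a\<in>A - H. (+) a ` F)" using x(1) by blast
    qed
    then have "card (carrier_vec n - H) \<le> card (\<Union>a\<in>A - H. (+) a ` F)"
      using finA bsubspace_finite[OF F(1)] by (intro card_mono) auto
    also have "\<dots> \<le> (\<Sum>a\<in>A - H. card ((+) a ` F))"
      using finA by (intro card_UN_le) auto
    also have "\<dots> \<le> (\<Sum>a\<in>A - H. card F)"
      by (intro sum_mono card_image_le bsubspace_finite[OF F(1)])
    finally have "card (carrier_vec n - H) \<le> card (A - H) * 16" using F(3) by simp
    moreover have "card (carrier_vec n - H) = 16 * 2 ^ m"
      using card_Diff_subset[OF bsubspace_finite[OF H(1)] bsubspace_carrier[OF H(1)]] H(2) cV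
      by (simp add: power_add)
    ultimately show "2 ^ m \<le> card (A - H)" by simp
  qed (use n E cA in \<open>auto simp: A_def\<close>)
  have "\<exists>W. witness e W" if e: "e \<in> E" for e
  proof -
    have ec: "e \<in> carrier_vec n" "e \<noteq> 0\<^sub>v n" using e E by auto
    obtain H where H: "bsubspace n H" "2 * card H = 2 ^ n" "e \<notin> H"
      using bsubspace_hyperplane_avoiding[OF ec] by blast
    have cH: "card H = 2 ^ (m + 4)" using H(2) n by (simp add: power_add)
    define D where "D = {x \<in> H. x \<in> E \<and> e + x \<in> E}"
    have DH: "D \<subseteq> H - {0\<^sub>v n}" using E(2) by (auto simp: D_def)
    have "card (H - D) \<le> card A"
    proof (rule card_inj_on_le[OF _ _ finA])
      \<comment> \<open>For \<open>x\<close> in \<open>H - D\<close> one of \<open>x\<close> and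
        \<open>e + x\<close> is in \<open>A\<close>. Choices do not collide because
        \<open>e + x\<close> lies outside \<open>H\<close>.\<close>
      let ?h = "\<lambda>x. if x \<in> A then x else e + x"
      have neq: "e + x \<noteq> y" if "x \<in> H" "y \<in> H" for x y
      proof
        assume "e + x = y"
        then have "x + e \<in> H"
          using that comm_add_vec[OF ec(1)] bsubspace_carrier[OF H(1)] by auto
        then show False using bsubspace_add_iff[OF H(1) that(1) ec(1)] H(3) by blast
      qed
      have inj: "inj_on ((+) e) H" by (rule inj_on_bvec_add[OF ec(1) bsubspace_carrier[OF H(1)]])
      show "inj_on ?h (H - D)"
      proof (rule inj_onI)
        fix x y assume xy: "x \<in> H - D" "y \<in> H - D" "?h x = ?h y"
        then show "x = y"
          using neq[of x y] neq[of y x] inj_onD[OF inj, of x y]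
          by (auto split: if_splits)
      qed
      show "?h ` (H - D) \<subseteq> A"
        using bsubspace_carrier[OF H(1)] ec(1) by (auto simp: D_def A_def)
    qed
    \<comment> \<open>A PG(3,2) inside \<open>D\<close> would extend by \<open>e\<close> to a
      PG(4,2) inside \<open>E\<close>.\<close>
    moreover have "\<not> F - {0\<^sub>v n} \<subseteq> D" if F: "bsubspace n F" "F \<subseteq> H" "card F = 16" for F
    proof
      assume FD: "F - {0\<^sub>v n} \<subseteq> D"
      have "e + x \<in> E" if "x \<in> F" for x
        using that FD e ec by (cases "x = 0\<^sub>v n") (auto simp: D_def)
      then have "adjoin e F - {0\<^sub>v n} \<subseteq> E" using FD by (auto simp: adjoin_def D_def)
      then show False
        using no32 bsubspace_adjoin[OF F(1) ec(1)] card_adjoin[OF F(1) ec(1)] F(2,3) H(3) by auto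
    qed
    ultimately obtain X where X: "bsubspace n X" "X \<subseteq> H" "card X = 2 ^ m" "X \<inter> D = {}"
      using lift[OF H(1) cH DH] by blast
    have XA: "x \<in> A \<or> e + x \<in> A" if "x \<in> X" for x
      using that X(2,4) bsubspace_carrier[OF X(1)] ec(1) by (auto simp: D_def A_def)
    have "e + (e + x) = x" if "x \<in> X" for x
      using that bsubspace_carrier[OF X(1)] by (auto intro: bvec_add_cancel[OF ec(1)])
    \<comment> \<open>The condition is invariant under translation by \<open>e\<close>, so it passes
      from \<open>X\<close> to \<open>e + X\<close>.\<close>
    then have "w \<in> A \<or> e + w \<in> A" if "w \<in> adjoin e X" for w
      using that XA unfolding adjoin_def by (metis UnE imageE)
    moreover have "card (adjoin e X) = 2 ^ (m + 1)"
      using card_adjoin[OF X(1) ec(1)] X(2,3) H(3) by auto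
    ultimately show ?thesis
      using bsubspace_adjoin[OF X(1) ec(1)] adjoin_self[OF X(1) ec(1)] unfolding witness_def by blast
  qed
  then show False using some_without_witness by blast
qed

end
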